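(* Let $\{\phi^m\}_{m=0,\dots,M}$ be a basis of the space of polynomials of degree at most $M$ on $[t_n,t_{n+1}]$, let $\{(\xi^q,w_q)\}_{q=0,\dots,M}$ be the $(M+1)$-point Gauss–Lobatto or Gauss–Legendre quadrature rule on $[0,1]$, and let $\{\psi^m\}_{m=0,\dots,M}$ be the Lagrange polynomials on $[t_n,t_{n+1}]$ associated to the points $t_n+\Delta t\,\xi^q$. Then the ADER-IWF defined by the basis $\{\phi^m\}$ and the quadrature $\{(\xi^q,w_q)\}$, namely $$\sum_{m=0}^M\Big[\widehat\phi^\ell(1)\widehat\phi^m(1)-\sum_{q=0}^M w_q\Big(\tfrac{d}{d\xi}\widehat\phi^\ell\Big)(\xi^q)\widehat\phi^m(\xi^q)\Big]\boldsymbol{u}^m-\widehat\phi^\ell(0)\boldsymbol{u}_n-\Delta t\sum_{q=0}^M w_q\,\widehat\phi^\ell(\xi^q)\,\boldsymbol{G}\Big(t_n+\Delta t\,\xi^q,\sum_{m=0}^M\boldsymbol{u}^m\widehat\phi^m(\xi^q)\Big)=\boldsymbol{0},\quad \ell=0,\dots,M,$$ in the unknowns $\boldsymbol{u}^0,\dots,\boldsymbol{u}^M\in\mathbb{R}^Q$, is equivalent to the ADER-IWF defined by the nodal basis $\{\psi^m\}$ with integrals computed through the same quadrature, namely $$\sum_{m=0}^M\Big[\widehat\psi^\ell(1)\widehat\psi^m(1)-\sum_{q=0}^M w_q\Big(\tfrac{d}{d\xi}\widehat\psi^\ell\Big)(\xi^q)\widehat\psi^m(\xi^q)\Big]\boldsymbol{v}^m-\widehat\psi^\ell(0)\boldsymbol{u}_n-\Delta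 t\sum_{m=0}^M\Big(\sum_{q=0}^M w_q\widehat\psi^\ell(\xi^q)\widehat\psi^m(\xi^q)\Big)\boldsymbol{G}(t_n+\Delta t\,\xi^m,\boldsymbol{v}^m)=\boldsymbol{0},\quad \ell=0,\dots,M,$$ in the unknowns $\boldsymbol{v}^0,\dots,\boldsymbol{v}^M\in\mathbb{R}^Q$. Here equivalent means: $(\boldsymbol{u}^m)_m$ solves the first system if and only if $(\boldsymbol{v}^q)_q$ with $\boldsymbol{v}^q=\sum_{m=0}^M\boldsymbol{u}^m\widehat\phi^m(\xi^q)$ solves the second one; i.e. the two systems determine the same polynomials $\boldsymbol{u}_h(t)=\sum_m\boldsymbol{u}^m\phi^m(t)=\sum_q\boldsymbol{v}^q\psi^q(t)$.
   Context: Setting: the ODE system $\frac{d}{dt}\boldsymbol{u}=\boldsymbol{G}(t,\boldsymbol{u})$ with $\boldsymbol{u}(t)\in\mathbb{R}^Q$, on a time step $[t_n,t_{n+1}]$, $t_{n+1}=t_n+\Delta t$, $\Delta t>0$, with given $\boldsymbol{u}_n\in\mathbb{R}^Q$. $\boldsymbol{G}$ is continuous and Lipschitz in $\boldsymbol{u}$ uniformly in $t$. A hat denotes rescaling to $[0,1]$: $\widehat f(\xi)=f(t_n+\Delta t\,\xi)$. "ADER-IWF" (ADER implicit weak form) is the nonlinear algebraic system obtained by discretizing the weak formulation of the ODE on $[t_n,t_{n+1}]$ in a polynomial basis with the given quadrature, as displayed in the claim. The Gauss–Lobatto points on $[0,1]$ are $0$, $1$ and the roots of the derivative of the shifted Legendre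 polynomial of degree $M$ (here $M\ge1$; the rule is exact for degree at most $2M-1$); the Gauss–Legendre points are the roots of the shifted Legendre polynomial of degree $M+1$ (exact for degree at most $2M+1$). The weights are $w_q=\int_0^1\widehat\psi^q(\xi)\,d\xi$. *)

theory Defs
  imports "HOL-Analysis.Analysis" "HOL-Computational_Algebra.Polynomial"
begin

text \<open>
  Scalar polynomials are elements of type \<^typ>\<open>real poly\<close>. On an interval of positive length
  these are in bijection with polynomial functions. Vector-valued families are functions
  on \<^typ>\<open>nat\<close> of which only the indices \<open>0, \<dots>, M\<close> are relevant.
\<close>

interpretation real_poly: vector_space "smult :: real \<Rightarrow> real poly \<Rightarrow> real poly"
  by unfold_locales (simp_all add: smult_add_right smult_add_left)

definition is_poly_basis :: "nat \<Rightarrow> (nat \<Rightarrow> real poly) \<Rightarrow> bool" where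
  "is_poly_basis M \<phi> \<longleftrightarrow>
     inj_on \<phi> {..M} \<and>
     \<not> real_poly.dependent (\<phi> ` {..M}) \<and>
     real_poly.span (\<phi> ` {..M}) = {p. degree p \<le> M}"

definition rescale :: "real \<Rightarrow> real \<Rightarrow> real poly \<Rightarrow> real poly" where
  "rescale tn dt p = pcompose p [:tn, dt:]"

lemma poly_rescale: "poly (rescale tn dt p) \<xi> = poly p (tn + dt * \<xi>)"
  by (simp add: rescale_def poly_pcompose mult.commute)

definition lagrange_poly :: "nat \<Rightarrow> (nat \<Rightarrow> real) \<Rightarrow> nat \<Rightarrow> real poly" where
  "lagrange_poly M x m =
     (\<Prod>j\<in>{..M} - {m}. smult (1 / (x m - x j)) [:- x j, 1:])"

text \<open>
  Rodrigues' formula on \<open>[0,1]\<close>: the value at \<open>x\<close> is \<open>P\<^sub>n (2 x - 1)\<close> for the classical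
  Legendre polynomial \<open>P\<^sub>n\<close> on \<open>[-1,1]\<close>.
\<close>

definition shifted_legendre :: "nat \<Rightarrow> real poly" where
  "shifted_legendre n = smult (1 / fact n) ((pderiv ^^ n) ([:0, -1, 1:] ^ n))"

text \<open>The points may be enumerated in any order, without repetition.\<close>

definition gauss_lobatto_points :: "nat \<Rightarrow> (nat \<Rightarrow> real) \<Rightarrow> bool" where
  "gauss_lobatto_points M \<xi> \<longleftrightarrow>
     1 \<le> M \<and>
     bij_betw \<xi> {..M} ({0, 1} \<union> {x. poly (pderiv (shifted_legendre M)) x = 0})"

definition gauss_legendre_points :: "nat \<Rightarrow> (nat \<Rightarrow> real) \<Rightarrow> bool" where
  "gauss_legendre_points M \<xi> \<longleftrightarrow>
     bij_betw \<xi> {..M} {x. poly (shifted_legendre (M + 1)) x = 0}"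

definition poly_expansion ::
  "nat \<Rightarrow> (nat \<Rightarrow> real poly) \<Rightarrow> (nat \<Rightarrow> real ^ 'Q) \<Rightarrow> real \<Rightarrow> real ^ 'Q" where
  "poly_expansion M \<phi> u t = (\<Sum>m\<le>M. poly (\<phi> m) t *\<^sub>R u m)"

definition iwf_entry ::
  "nat \<Rightarrow> (nat \<Rightarrow> real) \<Rightarrow> (nat \<Rightarrow> real) \<Rightarrow> (nat \<Rightarrow> real poly) \<Rightarrow> nat \<Rightarrow> nat \<Rightarrow> real" where
  "iwf_entry M \<xi> w \<beta> l m =
     poly (\<beta> l) 1 * poly (\<beta> m) 1
     - (\<Sum>q\<le>M. w q * poly (pderiv (\<beta> l)) (\<xi> q) * poly (\<beta> m) (\<xi> q))"

text \<open>
  In the two systems below the basis is given on the physical time step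
  \<open>[tn, tn + dt]\<close> and \<open>\<beta>\<close> denotes its rescaling to \<open>[0,1]\<close>.
\<close>

definition ader_iwf ::
  "nat \<Rightarrow> (nat \<Rightarrow> real) \<Rightarrow> (nat \<Rightarrow> real) \<Rightarrow> real \<Rightarrow> real \<Rightarrow>
   (real \<Rightarrow> real ^ 'Q \<Rightarrow> real ^ 'Q) \<Rightarrow> real ^ 'Q \<Rightarrow> (nat \<Rightarrow> real poly) \<Rightarrow>
   (nat \<Rightarrow> real ^ 'Q) \<Rightarrow> bool" where
  "ader_iwf M \<xi> w tn dt G un \<phi> u \<longleftrightarrow>
     (let \<beta> = (\<lambda>m. rescale tn dt (\<phi> m)) in
      \<forall>l\<le>M.
        (\<Sum>m\<le>M. iwf_entry M \<xi> w \<beta> l m *\<^sub>R u m)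
        - poly (\<beta> l) 0 *\<^sub>R un
        - dt *\<^sub>R (\<Sum>q\<le>M. (w q * poly (\<beta> l) (\<xi> q)) *\<^sub>R
            G (tn + dt * \<xi> q) (\<Sum>m\<le>M. poly (\<beta> m) (\<xi> q) *\<^sub>R u m)) = 0)"

text \<open>
  The nodal form replaces the source term by its interpolant at the quadrature points and
  computes the resulting mass matrix with the same quadrature.
\<close>

definition ader_iwf_nodal ::
  "nat \<Rightarrow> (nat \<Rightarrow> real) \<Rightarrow> (nat \<Rightarrow> real) \<Rightarrow> real \<Rightarrow> real \<Rightarrow>
   (real \<Rightarrow> real ^ 'Q \<Rightarrow> real ^ 'Q) \<Rightarrow> real ^ 'Q \<Rightarrow> (nat \<Rightarrow> real poly) \<Rightarrow>
   (nat \<Rightarrow> real ^ 'Q) \<Rightarrow> bool" where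
  "ader_iwf_nodal M \<xi> w tn dt G un \<psi> v \<longleftrightarrow>
     (let \<beta> = (\<lambda>m. rescale tn dt (\<psi> m)) in
      \<forall>l\<le>M.
        (\<Sum>m\<le>M. iwf_entry M \<xi> w \<beta> l m *\<^sub>R v m)
        - poly (\<beta> l) 0 *\<^sub>R un
        - dt *\<^sub>R (\<Sum>m\<le>M. (\<Sum>q\<le>M. w q * poly (\<beta> l) (\<xi> q) * poly (\<beta> m) (\<xi> q)) *\<^sub>R
            G (tn + dt * \<xi> m) (v m)) = 0)"

end

theory Submission
  imports Defs
begin

text \<open>
  Both systems state that one residual functional, linear in the test polynomial, vanishes on a
  spanning set of the polynomials of degree at most \<open>M\<close>. The residual sees the unknowns only
  through the trial polynomial, and in the nodal system the quadrature mass matrix is diagonal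
  because the Lagrange polynomials are cardinal at the quadrature points.
\<close>

section \<open>Lagrange polynomials as a spanning family, and coefficients in a basis\<close>

lemma poly_lagrange_poly_node:
  assumes "inj_on x {..M}" "i \<le> M" "j \<le> M"
  shows "poly (lagrange_poly M x i) (x j) = (if i = j then 1 else 0)"
proof (cases "i = j")
  case True
  have "(\<Prod>k\<in>{..M} - {j}. (x j - x k) / (x j - x k)) = 1"
    using assms by (intro prod.neutral) (auto simp: inj_on_def)
  then show ?thesis
    using True by (simp add: lagrange_poly_def poly_prod diff_divide_distrib del: divide_self_if)
next
  case False
  \<comment> \<open>As \<open>j\<close> differs from \<open>i\<close>, the factor with index
    \<open>j\<close> occurs in the product, and it vanishes at \<open>x j\<close>.\<close>
  then show ?thesis
    using assms by (auto simp: lagrange_poly_def poly_prod intro!: prod_zero)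
qed

lemma degree_lagrange_poly_le:
  assumes "i \<le> M"
  shows "degree (lagrange_poly M x i) \<le> M"
proof -
  have "degree (lagrange_poly M x i)
      \<le> (\<Sum>j\<in>{..M} - {i}. degree (smult (1 / (x i - x j)) [:- x j, 1:]))"
    unfolding lagrange_poly_def by (rule order_trans[OF degree_prod_sum_le]) (simp_all add: o_def)
  also have "\<dots> \<le> (\<Sum>j\<in>{..M} - {i}. 1)"
    by (intro sum_mono) auto
  also have "\<dots> = M"
    using assms by simp
  finally show ?thesis .
qed

text \<open>Both sides have degree at most \<open>M\<close> and agree at \<open>M + 1\<close>
  distinct nodes, by cardinality of the Lagrange polynomials, so they coincide.\<close>

lemma lagrange_interpolation:
  assumes inj: "inj_on x {..M}" and deg: "degree p \<le> M"
  shows "p = (\<Sum>q\<le>M. smult (poly p (x q)) (lagrange_poly M x q))"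
    (is "p = ?r")
proof (rule poly_eqI_degree[where A = "x ` {..M}"])
  fix y assume "y \<in> x ` {..M}"
  then obtain j where j: "j \<le> M" "y = x j" by auto
  have "poly ?r y = (\<Sum>q\<le>M. if j = q then poly p (x q) else 0)"
    unfolding poly_sum j(2) using j(1)
    by (intro sum.cong) (auto simp: poly_lagrange_poly_node[OF inj])
  then show "poly p y = poly ?r y"
    using j by simp
next
  have card: "card (x ` {..M}) = Suc M"
    using inj by (simp add: card_image)
  then show "degree p < card (x ` {..M})"
    using deg by simp
  have "degree ?r \<le> M"
    by (intro degree_sum_le)
      (auto intro: order_trans[OF degree_smult_le] degree_lagrange_poly_le)
  then show "degree ?r < card (x ` {..M})"
    using card by simp
qed

lemma span_lagrange_poly:
  assumes inj: "inj_on x {..M}"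
  shows "real_poly.span (lagrange_poly M x ` {..M}) = {p. degree p \<le> M}"
    (is "?S = ?D")
proof (rule subset_antisym)
  have "real_poly.subspace ?D"
    unfolding real_poly.subspace_def
    by (auto intro: degree_add_le order_trans[OF degree_smult_le])
  then show "?S \<subseteq> ?D"
    by (intro real_poly.span_minimal) (auto intro: degree_lagrange_poly_le)
  show "?D \<subseteq> ?S"
  proof
    fix p assume "p \<in> ?D"
    then have "p = (\<Sum>q\<le>M. smult (poly p (x q)) (lagrange_poly M x q))"
      using lagrange_interpolation[OF inj] by simp
    moreover have "\<dots> \<in> ?S"
      by (intro real_poly.span_sum real_poly.span_scale real_poly.span_base) auto
    ultimately show "p \<in> ?S" by simp
  qed
qed

lemma poly_basis_coefficients:
  assumes "is_poly_basis M \<phi>" "degree p \<le> M"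
  obtains c where "p = (\<Sum>m\<le>M. smult (c m) (\<phi> m))"
proof -
  have inj: "inj_on \<phi> {..M}" and "p \<in> real_poly.span (\<phi> ` {..M})"
    using assms by (auto simp: is_poly_basis_def)
  then obtain r where "p = (\<Sum>b\<in>\<phi> ` {..M}. smult (r b) b)"
    by (auto simp: real_poly.span_finite)
  \<comment> \<open>Span coefficients are attached to the basis polynomials themselves; injectivity
    of \<phi> turns them into coefficients attached to indices.\<close>
  then have "p = (\<Sum>m\<le>M. smult (r (\<phi> m)) (\<phi> m))"
    using inj by (simp add: sum.reindex)
  then show thesis by (rule that)
qed

section \<open>The residual as a linear functional of the test polynomial\<close>

text \<open>The trial function \<open>U\<close> is an argument in place of a coefficient family, so
  that no basis enters. Derivatives are taken after rescaling, as in the two systems.\<close>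

definition weak_residual ::
  "nat \<Rightarrow> (nat \<Rightarrow> real) \<Rightarrow> (nat \<Rightarrow> real) \<Rightarrow> real \<Rightarrow> real \<Rightarrow>
   (real \<Rightarrow> real ^ 'Q \<Rightarrow> real ^ 'Q) \<Rightarrow> real ^ 'Q \<Rightarrow> (real \<Rightarrow> real ^ 'Q) \<Rightarrow>
   real poly \<Rightarrow> real ^ 'Q" where
  "weak_residual M \<xi> w tn dt G un U p =
     (let b = rescale tn dt p in
      poly b 1 *\<^sub>R U (tn + dt)
      - (\<Sum>q\<le>M. (w q * poly (pderiv b) (\<xi> q)) *\<^sub>R U (tn + dt * \<xi> q))
      - poly b 0 *\<^sub>R un
      - dt *\<^sub>R (\<Sum>q\<le>M. (w q * poly b (\<xi> q)) *\<^sub>R G (tn + dt * \<xi> q) (U (tn + dt * \<xi> q))))"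

lemma rescale_add: "rescale tn dt (p + q) = rescale tn dt p + rescale tn dt q"
  by (simp add: rescale_def pcompose_add)

lemma rescale_smult: "rescale tn dt (smult c p) = smult c (rescale tn dt p)"
  by (simp add: rescale_def pcompose_smult)

text \<open>Here \<open>U\<close> is fixed. Even the initial-value term and the nonlinear source
  carry a value of the rescaled test polynomial as scalar factor, hence are linear in it.\<close>

lemma linear_weak_residual:
  "Vector_Spaces.linear smult scaleR (weak_residual M \<xi> w tn dt G un U)"
proof (intro Vector_Spaces.linear.intro module_hom.intro module_hom_axioms.intro)
  show "vector_space (smult :: real \<Rightarrow> real poly \<Rightarrow> real poly)"
    "module (smult :: real \<Rightarrow> real poly \<Rightarrow> real poly)"
    by unfold_locales
  show "vector_space (scaleR :: real \<Rightarrow> real ^ 'a \<Rightarrow> real ^ 'a)"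
    "module (scaleR :: real \<Rightarrow> real ^ 'a \<Rightarrow> real ^ 'a)"
    by unfold_locales
next
  fix p q
  show "weak_residual M \<xi> w tn dt G un U (p + q) =
      weak_residual M \<xi> w tn dt G un U p + weak_residual M \<xi> w tn dt G un U q"
    by (simp add: weak_residual_def Let_def rescale_add pderiv_add algebra_simps sum.distrib)
next
  fix c p
  show "weak_residual M \<xi> w tn dt G un U (smult c p) = c *\<^sub>R weak_residual M \<xi> w tn dt G un U p"
    by (simp add: weak_residual_def Let_def rescale_smult pderiv_smult scaleR_diff_right
        scaleR_sum_right ac_simps)
qed

text \<open>A linear map that vanishes on a family vanishes on its span. The right-hand side no
  longer mentions \<open>b\<close>, so any two spanning families impose the same condition on
  \<open>U\<close>.\<close>

lemma weak_residual_vanishes_iff: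
  assumes "real_poly.span (b ` {..M}) = {p. degree p \<le> M}"
  shows "(\<forall>l\<le>M. weak_residual M \<xi> w tn dt G un U (b l) = 0) \<longleftrightarrow>
    (\<forall>p. degree p \<le> M \<longrightarrow> weak_residual M \<xi> w tn dt G un U p = 0)"
proof -
  interpret R: Vector_Spaces.linear smult scaleR "weak_residual M \<xi> w tn dt G un U"
    by (rule linear_weak_residual)
  have "degree (b l) \<le> M" if "l \<le> M" for l
    using real_poly.span_base[of "b l" "b ` {..M}"] that assms by auto
  moreover have "weak_residual M \<xi> w tn dt G un U p = 0"
    if "\<forall>l\<le>M. weak_residual M \<xi> w tn dt G un U (b l) = 0" "degree p \<le> M" for p
    using R.eq_0_on_span[of "b ` {..M}" p] that assms by auto
  ultimately show ?thesis by blast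
qed

section \<open>The two systems as residual conditions\<close>

text \<open>Exchanging the sums over \<open>m\<close> and \<open>q\<close> gathers the unknowns into
  values of the trial polynomial at the end of the step and at the nodes.\<close>

lemma sum_iwf_entry:
  "(\<Sum>m\<le>M. iwf_entry M \<xi> w (\<lambda>m. rescale tn dt (\<phi> m)) l m *\<^sub>R u m) =
    poly (rescale tn dt (\<phi> l)) 1 *\<^sub>R poly_expansion M \<phi> u (tn + dt)
    - (\<Sum>q\<le>M. (w q * poly (pderiv (rescale tn dt (\<phi> l))) (\<xi> q)) *\<^sub>R
        poly_expansion M \<phi> u (tn + dt * \<xi> q))"
proof -
  have "(\<Sum>m\<le>M. (\<Sum>q\<le>M. w q * poly (pderiv (rescale tn dt (\<phi> l))) (\<xi> q) *
        poly (rescale tn dt (\<phi> m)) (\<xi> q)) *\<^sub>R u m) =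
      (\<Sum>q\<le>M. (w q * poly (pderiv (rescale tn dt (\<phi> l))) (\<xi> q)) *\<^sub>R
        poly_expansion M \<phi> u (tn + dt * \<xi> q))"
    unfolding poly_expansion_def scaleR_sum_left scaleR_sum_right
    by (subst sum.swap) (simp add: poly_rescale)
  then show ?thesis
    by (simp add: iwf_entry_def scaleR_diff_left sum_subtractf poly_expansion_def poly_rescale
        scaleR_sum_right)
qed

lemma ader_iwf_iff_weak_residual:
  "ader_iwf M \<xi> w tn dt G un \<phi> u \<longleftrightarrow>
    (\<forall>l\<le>M. weak_residual M \<xi> w tn dt G un (poly_expansion M \<phi> u) (\<phi> l) = 0)"
  unfolding ader_iwf_def weak_residual_def Let_def sum_iwf_entry
  by (simp add: poly_expansion_def poly_rescale)

lemma poly_expansion_node: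
  assumes "\<And>i j. i \<le> M \<Longrightarrow> j \<le> M \<Longrightarrow> poly (\<psi> i) (x j) = (if i = j then 1 else 0)" "q \<le> M"
  shows "poly_expansion M \<psi> v (x q) = v q"
proof -
  have "poly_expansion M \<psi> v (x q) = (\<Sum>m\<le>M. if q = m then v m else 0)"
    unfolding poly_expansion_def using assms by (intro sum.cong) auto
  then show ?thesis using assms(2) by simp
qed

text \<open>Cardinality acts twice: it makes the quadrature mass matrix collapse to a single term
  per column, and it identifies \<open>v m\<close> with the nodal value of the trial polynomial, so
  the source becomes that of the residual.\<close>

lemma ader_iwf_nodal_iff_weak_residual:
  assumes cardinal: "\<And>i j. i \<le> M \<Longrightarrow> j \<le> M \<Longrightarrow>
    poly (\<psi> i) (tn + dt * \<xi> j) = (if i = j then 1 else 0)"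
  shows "ader_iwf_nodal M \<xi> w tn dt G un \<psi> v \<longleftrightarrow>
    (\<forall>l\<le>M. weak_residual M \<xi> w tn dt G un (poly_expansion M \<psi> v) (\<psi> l) = 0)"
proof -
  have mass: "(\<Sum>q\<le>M. w q * poly (rescale tn dt (\<psi> l)) (\<xi> q) * poly (rescale tn dt (\<psi> m)) (\<xi> q))
      = w m * poly (rescale tn dt (\<psi> l)) (\<xi> m)" if "m \<le> M" for l m
  proof -
    have "(\<Sum>q\<le>M. w q * poly (rescale tn dt (\<psi> l)) (\<xi> q) * poly (rescale tn dt (\<psi> m)) (\<xi> q))
        = (\<Sum>q\<le>M. if m = q then w q * poly (rescale tn dt (\<psi> l)) (\<xi> q) else 0)"
      using that by (intro sum.cong) (auto simp: poly_rescale cardinal)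
    then show ?thesis using that by simp
  qed
  have node: "poly_expansion M \<psi> v (tn + dt * \<xi> q) = v q" if "q \<le> M" for q
    using poly_expansion_node[where x = "\<lambda>q. tn + dt * \<xi> q"] cardinal that by blast
  show ?thesis
    unfolding ader_iwf_nodal_def weak_residual_def Let_def sum_iwf_entry
    by (simp add: mass node)
qed

section \<open>Passing between expansions in the two families\<close>

lemma poly_expansion_eq_lagrange:
  assumes inj: "inj_on x {..M}"
    and deg: "\<And>m. m \<le> M \<Longrightarrow> degree (\<phi> m) \<le> M"
    and v: "\<And>q. q \<le> M \<Longrightarrow> v q = poly_expansion M \<phi> u (x q)"
  shows "poly_expansion M \<phi> u = poly_expansion M (lagrange_poly M x) v"
proof
  fix t
  have "poly (\<phi> m) t = (\<Sum>q\<le>M. poly (\<phi> m) (x q) * poly (lagrange_poly M x q) t)"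
    if "m \<le> M" for m
    using arg_cong[OF lagrange_interpolation[OF inj deg[OF that]], of "\<lambda>p. poly p t"]
    by (simp add: poly_sum)
  then have "poly_expansion M \<phi> u t =
      (\<Sum>m\<le>M. (\<Sum>q\<le>M. poly (\<phi> m) (x q) * poly (lagrange_poly M x q) t) *\<^sub>R u m)"
    unfolding poly_expansion_def by (intro sum.cong) auto
  also have "\<dots> = (\<Sum>q\<le>M. poly (lagrange_poly M x q) t *\<^sub>R v q)"
    unfolding scaleR_sum_left
    by (subst sum.swap) (simp add: v poly_expansion_def scaleR_sum_right mult.commute)
  finally show "poly_expansion M \<phi> u t = poly_expansion M (lagrange_poly M x) v t"
    by (simp add: poly_expansion_def)
qed

lemma poly_basis_expansion_exists:
  assumes basis: "is_poly_basis M \<phi>" and deg: "\<And>m. m \<le> M \<Longrightarrow> degree (\<psi> m) \<le> M"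
  obtains u where "poly_expansion M \<phi> u = poly_expansion M \<psi> v"
proof -
  have "\<exists>c. q \<le> M \<longrightarrow> \<psi> q = (\<Sum>m\<le>M. smult (c m) (\<phi> m))" for q
    using poly_basis_coefficients[OF basis deg] by metis
  then obtain c where c: "\<And>q. q \<le> M \<Longrightarrow> \<psi> q = (\<Sum>m\<le>M. smult (c q m) (\<phi> m))"
    by metis
  \<comment> \<open>Coefficients transform by the transpose of the matrix that writes each
    \<open>\<psi> q\<close> in the family \<phi>.\<close>
  define u where "u m = (\<Sum>q\<le>M. c q m *\<^sub>R v q)" for m
  have "poly_expansion M \<phi> u t = poly_expansion M \<psi> v t" for t
  proof -
    have "poly_expansion M \<psi> v t = (\<Sum>q\<le>M. \<Sum>m\<le>M. (c q m * poly (\<phi> m) t) *\<^sub>R v q)"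
      by (simp add: poly_expansion_def c poly_sum scaleR_sum_left)
    also have "\<dots> = poly_expansion M \<phi> u t"
      by (subst sum.swap) (simp add: poly_expansion_def u_def scaleR_sum_right mult.commute)
    finally show ?thesis by simp
  qed
  then show thesis by (intro that) auto
qed

theorem theorem3p10:
  fixes M :: nat
    and tn dt :: real
    and G :: "real \<Rightarrow> real ^ 'Q \<Rightarrow> real ^ 'Q"
    and un :: "real ^ 'Q"
    and \<phi> \<psi> :: "nat \<Rightarrow> real poly"
    and \<xi> w :: "nat \<Rightarrow> real"
  assumes dt_pos: "dt > 0"
    and G_cont: "continuous_on ({tn..tn + dt} \<times> UNIV) (\<lambda>(t, x). G t x)"
    and G_lipschitz: "\<exists>L. \<forall>t\<in>{tn..tn + dt}. L-lipschitz_on UNIV (G t)"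
    and basis: "is_poly_basis M \<phi>"
    and points: "gauss_lobatto_points M \<xi> \<or> gauss_legendre_points M \<xi>"
    and lagrange: "\<And>m. m \<le> M \<Longrightarrow> \<psi> m = lagrange_poly M (\<lambda>q. tn + dt * \<xi> q) m"
    and weights: "\<And>q. q \<le> M \<Longrightarrow> w q = integral {0..1} (poly (rescale tn dt (\<psi> q)))"
  shows "(\<forall>u v :: nat \<Rightarrow> real ^ 'Q.
            (\<forall>q\<le>M. v q = (\<Sum>m\<le>M. poly (rescale tn dt (\<phi> m)) (\<xi> q) *\<^sub>R u m)) \<longrightarrow>
              (ader_iwf M \<xi> w tn dt G un \<phi> u \<longleftrightarrow> ader_iwf_nodal M \<xi> w tn dt G un \<psi> v) \<and>
              poly_expansion M \<phi> u = poly_expansion M \<psi> v) \<and>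
         {poly_expansion M \<phi> u | u. ader_iwf M \<xi> w tn dt G un \<phi> u} =
         {poly_expansion M \<psi> v | v. ader_iwf_nodal M \<xi> w tn dt G un \<psi> v}"
proof -
  define x where "x q = tn + dt * \<xi> q" for q
  \<comment> \<open>Either rule enumerates its points bijectively, and the affine map to the time
    step preserves distinctness because \<open>dt > 0\<close>.\<close>
  have "inj_on \<xi> {..M}"
    using points by (auto simp: gauss_lobatto_points_def gauss_legendre_points_def bij_betw_def)
  then have inj: "inj_on x {..M}"
    using dt_pos by (auto simp: inj_on_def x_def)
  have \<psi>: "\<psi> m = lagrange_poly M x m" if "m \<le> M" for m
    using lagrange[OF that] by (simp add: x_def[abs_def])
  have span_\<phi>: "real_poly.span (\<phi> ` {..M}) = {p. degree p \<le> M}"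
    using basis by (simp add: is_poly_basis_def)
  have "\<psi> ` {..M} = lagrange_poly M x ` {..M}"
    using \<psi> by (intro image_cong) auto
  then have span_\<psi>: "real_poly.span (\<psi> ` {..M}) = {p. degree p \<le> M}"
    using span_lagrange_poly[OF inj] by simp
  have deg_\<phi>: "degree (\<phi> m) \<le> M" if "m \<le> M" for m
    using real_poly.span_base[of "\<phi> m" "\<phi> ` {..M}"] span_\<phi> that by auto
  have deg_\<psi>: "degree (\<psi> m) \<le> M" if "m \<le> M" for m
    using \<psi> degree_lagrange_poly_le that by simp
  have cardinal: "poly (\<psi> i) (x j) = (if i = j then 1 else 0)" if "i \<le> M" "j \<le> M" for i j
    using poly_lagrange_poly_node[OF inj that] \<psi> that by simp
  have expansion: "poly_expansion M \<phi> u = poly_expansion M \<psi> v"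
    if "\<And>q. q \<le> M \<Longrightarrow> v q = poly_expansion M \<phi> u (x q)" for u v :: "nat \<Rightarrow> real ^ 'Q"
    \<comment> \<open>\<psi> agrees with the Lagrange family only up to index \<open>M\<close>,
      which is all that the expansion sees.\<close>
    using poly_expansion_eq_lagrange[OF inj deg_\<phi> that] \<psi>
    by (simp add: poly_expansion_def[abs_def])
  have systems: "ader_iwf M \<xi> w tn dt G un \<phi> u \<longleftrightarrow> ader_iwf_nodal M \<xi> w tn dt G un \<psi> v"
    if "poly_expansion M \<phi> u = poly_expansion M \<psi> v" for u v
    \<comment> \<open>For a common trial polynomial, both systems reduce to the same condition: its
      residual vanishes on all test polynomials of degree at most \<open>M\<close>.\<close>
    using cardinal that
    by (simp add: ader_iwf_iff_weak_residual ader_iwf_nodal_iff_weak_residual x_def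
        weak_residual_vanishes_iff[OF span_\<phi>] weak_residual_vanishes_iff[OF span_\<psi>])
  have eq_sets: "{poly_expansion M \<phi> u | u. ader_iwf M \<xi> w tn dt G un \<phi> u} =
      {poly_expansion M \<psi> v | v. ader_iwf_nodal M \<xi> w tn dt G un \<psi> v}" (is "?A = ?B")
  proof (rule subset_antisym; rule subsetI)
    fix f assume "f \<in> ?A"
    then obtain u where u: "f = poly_expansion M \<phi> u" "ader_iwf M \<xi> w tn dt G un \<phi> u"
      by blast
    \<comment> \<open>The nodal unknowns are the values of the trial polynomial at the
      nodes.\<close>
    have "poly_expansion M \<phi> u = poly_expansion M \<psi> (\<lambda>q. poly_expansion M \<phi> u (x q))"
      by (rule expansion) simp
    then show "f \<in> ?B" using u systems by blast
  next
    fix f assume "f \<in> ?B"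
    then obtain v where v: "f = poly_expansion M \<psi> v" "ader_iwf_nodal M \<xi> w tn dt G un \<psi> v"
      by blast
    \<comment> \<open>Conversely, every nodal expansion has coefficients in \<phi>, since \<phi>
      spans; thus no nodal solution is missed.\<close>
    obtain u where "poly_expansion M \<phi> u = poly_expansion M \<psi> v"
      using poly_basis_expansion_exists[where \<psi> = \<psi>, OF basis deg_\<psi>] .
    with v systems[of u v] show "f \<in> ?A" by (intro CollectI exI[of _ u]) simp
  qed
  have "(ader_iwf M \<xi> w tn dt G un \<phi> u \<longleftrightarrow> ader_iwf_nodal M \<xi> w tn dt G un \<psi> v) \<and>
      poly_expansion M \<phi> u = poly_expansion M \<psi> v"
    if "\<forall>q\<le>M. v q = (\<Sum>m\<le>M. poly (rescale tn dt (\<phi> m)) (\<xi> q) *\<^sub>R u m)" for u v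
  proof -
    have "poly_expansion M \<phi> u = poly_expansion M \<psi> v"
      using that by (intro expansion) (simp add: poly_expansion_def poly_rescale x_def)
    then show ?thesis using systems by simp
  qed
  then show ?thesis using eq_sets by blast
qed

end
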